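(* Let $B=(b_1,\dots,b_L)$ be a base sequence of integers $b_i\ge2$, $P=\prod_{i=1}^L b_i$, let $\mathcal{M}$ be the message space, let $S\subseteq\mathcal{M}$ be any subset, and let $\Pr[M]$ be any distribution with support contained in $S$, i.e. $\Pr[M=m]=0$ for every $m\notin S$. The MR-OTP with a key $K$ uniform on $\mathcal{K}_B$ achieves perfect secrecy for this distribution: for every base sequence $b$, every ciphertext $c$ with $\Pr[C=c]>0$, and every $m$, $$\Pr[M=m\mid C=c,\,B=b]=\Pr[M=m].$$ When $|S|<P$, the key carries more entropy than the message requires, and the excess is $\log_2 P-\log_2|S|$ bits per message. The minimum key entropy consistent with perfect secrecy for the distribution $\Pr[M]$ concentrated on $S$ is $H(M)$, and the MR-OTP with base sequence $B$ achieves this minimum when $\prod_i b_i=|S|$, the key $K$ is uniform on $\mathcal{K}_B$, and $M$ is uniform on $S$, so that both the key and the message are drawn uniformly from spaces of equal cardinality.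
   Context: For a base sequence $B=(b_1,\dots,b_L)$ the key space is $\mathcal{K}_B=\prod_{i=1}^L\{0,\dots,b_i-1\}$, which is also the set $\mathcal{M}$ of messages and the set of ciphertexts. MR-OTP (Mixed-Radix One-Time Pad): the message $m$ is encrypted under the key $K=(k_1,\dots,k_L)$ as $c_i=(m_i+k_i)\bmod b_i$; the message $M$ is independent of the key and of the base sequence. $C$ is the random ciphertext. $H$ denotes Shannon entropy in bits.
   Formalization: "The minimum key entropy is H(M)" fails for non-uniform M (Pr=(3/4,1/4) on two messages needs at least 1 bit, while H(M)≈0.81); proved instead: H(M) is a lower bound for every Pr[M] on S, and is the attained minimum when M is uniform on S. *)

theory Defs
  imports "HOL-Probability.Probability"
begin

definition base_sequence :: "nat list \<Rightarrow> bool" where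
  "base_sequence bs \<longleftrightarrow> (\<forall>b\<in>set bs. 2 \<le> b)"

definition key_space :: "nat list \<Rightarrow> nat list set" where
  "key_space bs = {ks. length ks = length bs \<and> (\<forall>i<length bs. ks ! i < bs ! i)}"

definition mr_otp :: "nat list \<Rightarrow> nat list \<Rightarrow> nat list \<Rightarrow> nat list" where
  "mr_otp bs k m = map (\<lambda>i. (m ! i + k ! i) mod (bs ! i)) [0..<length bs]"

text \<open>
  Shannon entropy in bits of a discrete distribution: the library entropy, to base 2, of the
  identity random variable relative to counting measure. Counting measure is sigma-finite only
  on countable types, hence the sort constraint.  If the series
  \<open>\<Sum>x. pmf p x * log 2 (pmf p x)\<close> diverges, the value is the default \<open>0\<close> of the
  Bochner integral, not infinity; see \<open>finite_key_entropy\<close>.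
\<close>
definition shannon_entropy :: "'a::countable pmf \<Rightarrow> real" where
  "shannon_entropy p = prob_space.entropy (measure_pmf p) 2 (count_space UNIV) (\<lambda>x. x)"

definition finite_key_entropy :: "'k pmf \<Rightarrow> bool" where
  "finite_key_entropy \<kappa> \<longleftrightarrow> integrable (measure_pmf \<kappa>) (\<lambda>k. log 2 (pmf \<kappa> k))"

text \<open>
  A cipher is given by a key distribution \<open>\<kappa>\<close> and an encryption map \<open>enc k m\<close>, which may be
  randomized; deterministic ciphers such as MR-OTP return point masses.  The experiment yields
  the joint law of \<open>(M, C)\<close>, with \<open>M\<close> and \<open>K\<close> drawn independently.
\<close>
definition cipher_experiment ::
    "'m pmf \<Rightarrow> 'k pmf \<Rightarrow> ('k \<Rightarrow> 'm \<Rightarrow> 'c pmf) \<Rightarrow> ('m \<times> 'c) pmf" where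
  "cipher_experiment p \<kappa> enc =
     do { m \<leftarrow> p; k \<leftarrow> \<kappa>; c \<leftarrow> enc k m; return_pmf (m, c) }"

definition perfectly_secret ::
    "'m pmf \<Rightarrow> 'k pmf \<Rightarrow> ('k \<Rightarrow> 'm \<Rightarrow> 'c pmf) \<Rightarrow> bool" where
  "perfectly_secret p \<kappa> enc \<longleftrightarrow>
     (let \<Omega> = measure_pmf (cipher_experiment p \<kappa> enc) in
        \<forall>c. \<P>(\<omega> in \<Omega>. snd \<omega> = c) > 0 \<longrightarrow>
          (\<forall>m. \<P>(\<omega> in \<Omega>. fst \<omega> = m \<bar> snd \<omega> = c) = \<P>(\<omega> in \<Omega>. fst \<omega> = m)))"

definition decryptable ::
    "'m pmf \<Rightarrow> 'k pmf \<Rightarrow> ('k \<Rightarrow> 'm \<Rightarrow> 'c pmf) \<Rightarrow> bool" where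
  "decryptable p \<kappa> enc \<longleftrightarrow>
     (\<exists>dec. \<forall>m\<in>set_pmf p. \<forall>k\<in>set_pmf \<kappa>. \<forall>c\<in>set_pmf (enc k m). dec k c = m)"

text \<open>
  The ciphers over which the key entropy is minimized.  Decryption is only required on the support
  of the message distribution.  Any such cipher also protects the uniform distribution on
  \<open>set_pmf p\<close>, so its key entropy is at least \<open>log 2 (card (set_pmf p))\<close>: Shannon's lower bound
  \<open>H(M)\<close> can be attained only if \<open>M\<close> is uniform on its support.
\<close>
definition secret_cipher ::
    "'m pmf \<Rightarrow> 'k pmf \<Rightarrow> ('k \<Rightarrow> 'm \<Rightarrow> 'c pmf) \<Rightarrow> bool" where
  "secret_cipher p \<kappa> enc \<longleftrightarrow>
     decryptable p \<kappa> enc \<and> perfectly_secret p \<kappa> enc \<and> finite_key_entropy \<kappa>"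

abbreviation mr_otp_key :: "nat list \<Rightarrow> nat list pmf" where
  "mr_otp_key bs \<equiv> pmf_of_set (key_space bs)"

abbreviation mr_otp_enc :: "nat list \<Rightarrow> nat list \<Rightarrow> nat list \<Rightarrow> nat list pmf" where
  "mr_otp_enc bs k m \<equiv> return_pmf (mr_otp bs k m)"

text \<open>
  Joint law of \<open>(B, M, C)\<close> when the base sequence is itself random with law \<open>\<beta>\<close>: \<open>M\<close> is independent
  of \<open>(B, K)\<close>, and given \<open>B = b\<close> the key is uniform on \<open>key_space b\<close>.  A fixed base sequence
  is the case of a point mass \<open>\<beta>\<close>.
\<close>
definition mr_otp_experiment ::
    "nat list pmf \<Rightarrow> nat list pmf \<Rightarrow> (nat list \<times> nat list \<times> nat list) pmf" where
  "mr_otp_experiment \<beta> p =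
     do { b \<leftarrow> \<beta>; m \<leftarrow> p; k \<leftarrow> mr_otp_key b; return_pmf (b, m, mr_otp b k m) }"

end

theory Submission
  imports Defs
begin

text \<open>
  For a fixed message, encryption permutes the key space, so a uniform key makes the ciphertext
  uniform and independent of the message.  For the lower bound, perfect secrecy
  says that all messages induce the same ciphertext distribution \<open>\<nu>\<close>.  Fix a key \<open>k\<close>: the sets of
  ciphertexts of the different messages under \<open>k\<close> are disjoint by decryptability, and each of them
  has \<open>\<nu>\<close>-mass at least the probability of \<open>k\<close>.  Hence every key has probability at most
  \<open>1 / card (set_pmf p)\<close>, so already the min-entropy of the key is at least
  \<open>log 2 (card (set_pmf p))\<close>, which bounds the entropy of the message from above.
\<close>

section \<open>Entropy of discrete laws and its bounds\<close>

text \<open>In expectation form, pointwise facts about \<open>pmf p x\<close> need only hold on the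
  support.\<close>

lemma shannon_entropy_eq_expectation:
  "shannon_entropy p = measure_pmf.expectation p (\<lambda>x. - log 2 (pmf p x))"
proof -
  interpret information_space "measure_pmf p" 2
    by unfold_locales auto
  have "distributed (measure_pmf p) (count_space UNIV) (\<lambda>x. x) (pmf p)"
    by (simp add: distributed_def distr_id2 measure_pmf_eq_density)
  then have "shannon_entropy p = - (\<integral>x. pmf p x * log 2 (pmf p x) \<partial>count_space UNIV)"
    unfolding shannon_entropy_def by (rule entropy_distr) auto
  then show ?thesis
    by (simp add: measure_pmf_eq_density integral_density)
qed

lemma shannon_entropy_le_log_card:
  assumes "finite A" and "set_pmf p \<subseteq> A"
  shows "shannon_entropy p \<le> log 2 (card A)"
proof -
  interpret information_space "measure_pmf p" 2
    by unfold_locales auto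
  have fin: "finite (set_pmf p)"
    using assms by (rule rev_finite_subset)
  have supp: "{x. pmf p x \<noteq> 0} = set_pmf p"
    by (auto simp: set_pmf_eq)
  have "distributed (measure_pmf p) (count_space UNIV) (\<lambda>x. x) (pmf p)"
    by (simp add: distributed_def distr_id2 measure_pmf_eq_density)
  \<comment> \<open>Finite support supplies the integrability that \<open>entropy_le\<close> asks
    for.\<close>
  moreover have "integrable (count_space UNIV) (\<lambda>x. - pmf p x * log 2 (pmf p x))"
    using integrable_measure_pmf_finite[OF fin, of "\<lambda>x. - log 2 (pmf p x)"]
    unfolding measure_pmf_eq_density by (subst (asm) integrable_density) auto
  ultimately have "shannon_entropy p \<le> log 2 (measure (count_space UNIV) (set_pmf p))"
    unfolding shannon_entropy_def supp[symmetric]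
    using entropy_le[of "count_space UNIV" "\<lambda>x. x" "pmf p"] fin
    by (simp add: supp)
  also have "measure (count_space UNIV) (set_pmf p) = card (set_pmf p)"
    using fin by (simp add: measure_count_space)
  also have "log 2 (card (set_pmf p)) \<le> log 2 (card A)"
    using assms fin set_pmf_not_empty[of p]
    by (intro log_mono) (auto simp: card_gt_0_iff intro: card_mono)
  finally show ?thesis .
qed

lemma shannon_entropy_pmf_of_set:
  assumes "finite A" and "A \<noteq> {}"
  shows "shannon_entropy (pmf_of_set A) = log 2 (card A)"
proof -
  have "shannon_entropy (pmf_of_set A) =
      measure_pmf.expectation (pmf_of_set A) (\<lambda>_. log 2 (card A))"
    unfolding shannon_entropy_eq_expectation
    by (rule integral_cong_AE) (use assms in \<open>auto simp: AE_measure_pmf_iff log_divide\<close>)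
  then show ?thesis by simp
qed

lemma finite_key_entropy_finite_support:
  "finite (set_pmf \<kappa>) \<Longrightarrow> finite_key_entropy \<kappa>"
  unfolding finite_key_entropy_def by (rule integrable_measure_pmf_finite)

text \<open>The hypothesis bounds the min-entropy from below, and a mean is at least any pointwise
  lower bound.\<close>

lemma log_le_shannon_entropy:
  assumes "finite_key_entropy \<kappa>" and "0 < n"
    and le: "\<And>k. k \<in> set_pmf \<kappa> \<Longrightarrow> n * pmf \<kappa> k \<le> 1"
  shows "log 2 n \<le> shannon_entropy \<kappa>"
proof -
  have "log 2 n = measure_pmf.expectation \<kappa> (\<lambda>_. log 2 n)"
    by simp
  also have "\<dots> \<le> measure_pmf.expectation \<kappa> (\<lambda>k. - log 2 (pmf \<kappa> k))"
  proof (rule integral_mono_AE)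
    \<comment> \<open>\<open>finite_key_entropy\<close> enters here: for a divergent series the
      expectation would default to 0 and could fall below \<open>log 2 n\<close>.\<close>
    show "integrable \<kappa> (\<lambda>k. - log 2 (pmf \<kappa> k))"
      using assms(1) by (simp add: finite_key_entropy_def)
    have "log 2 n \<le> - log 2 (pmf \<kappa> k)" if k: "k \<in> set_pmf \<kappa>" for k
    proof -
      have "log 2 n + log 2 (pmf \<kappa> k) = log 2 (n * pmf \<kappa> k)"
        using \<open>0 < n\<close> pmf_positive[OF k] by (simp add: log_mult)
      also have "\<dots> \<le> 0"
        using le[OF k] \<open>0 < n\<close> pmf_positive[OF k] by simp
      finally show ?thesis by simp
    qed
    then show "AE k in \<kappa>. log 2 n \<le> - log 2 (pmf \<kappa> k)"
      by (simp add: AE_measure_pmf_iff)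
  qed simp
  finally show ?thesis
    by (simp add: shannon_entropy_eq_expectation)
qed

section \<open>Perfect secrecy as independence, and the key entropy bound\<close>

lemma cond_prob_pair_pmf:
  fixes p :: "'a pmf" and \<nu> :: "'b pmf"
  assumes "0 < \<P>(\<omega> in pair_pmf p \<nu>. snd \<omega> = y)"
  shows "\<P>(\<omega> in pair_pmf p \<nu>. fst \<omega> = x \<bar> snd \<omega> = y) = \<P>(\<omega> in pair_pmf p \<nu>. fst \<omega> = x)"
proof -
  have "\<P>(\<omega> in pair_pmf p \<nu>. fst \<omega> = x \<and> snd \<omega> = y) = pmf (pair_pmf p \<nu>) (x, y)"
    unfolding pmf.rep_eq by (rule arg_cong2[where f = measure]) auto
  moreover have "\<P>(\<omega> in pair_pmf p \<nu>. snd \<omega> = y) = pmf (map_pmf snd (pair_pmf p \<nu>)) y"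
    by (simp add: pmf_map vimage_def)
  moreover have "\<P>(\<omega> in pair_pmf p \<nu>. fst \<omega> = x) = pmf (map_pmf fst (pair_pmf p \<nu>)) x"
    by (simp add: pmf_map vimage_def)
  ultimately show ?thesis
    using assms by (simp add: cond_prob_def pmf_pair map_fst_pair_pmf map_snd_pair_pmf)
qed

lemma map_fst_cipher_experiment: "map_pmf fst (cipher_experiment p \<kappa> enc) = p"
  by (simp add: cipher_experiment_def map_bind_pmf bind_return_pmf')

text \<open>Prior times channel: the second factor is the ciphertext law given \<open>m\<close>,
  averaged over the key and the randomness of \<open>enc\<close>.\<close>

lemma pmf_cipher_experiment:
  "pmf (cipher_experiment p \<kappa> enc) (m, c) = pmf p m * pmf (bind_pmf \<kappa> (\<lambda>k. enc k m)) c"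
proof -
  have "cipher_experiment p \<kappa> enc =
      bind_pmf p (\<lambda>m. map_pmf (Pair m) (bind_pmf \<kappa> (\<lambda>k. enc k m)))"
    by (simp add: cipher_experiment_def map_pmf_def bind_assoc_pmf)
  then have "pmf (cipher_experiment p \<kappa> enc) (m, c) =
      measure_pmf.expectation p
        (\<lambda>m'. measure (bind_pmf \<kappa> (\<lambda>k. enc k m')) (Pair m' -` {(m, c)}))"
    by (simp add: pmf_bind[of p] pmf_map)
  \<comment> \<open>Only \<open>m' = m\<close> contributes, since \<open>Pair m'\<close> cannot hit
    \<open>(m, c)\<close> otherwise.\<close>
  also have "\<dots> = (\<Sum>m'\<in>{m}.
      measure (bind_pmf \<kappa> (\<lambda>k. enc k m')) (Pair m' -` {(m, c)}) * pmf p m')"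
    by (rule integral_measure_pmf_real) (auto simp: vimage_def intro: ccontr)
  also have "\<dots> = pmf p m * pmf (bind_pmf \<kappa> (\<lambda>k. enc k m)) c"
    by (simp add: vimage_def pmf.rep_eq)
  finally show ?thesis .
qed

text \<open>A common ciphertext law makes the joint law a product. Off the support of
  \<open>p\<close> both sides have mass 0.\<close>

lemma perfectly_secretI:
  fixes p :: "'m pmf" and \<nu> :: "'c pmf"
  assumes "\<And>m. m \<in> set_pmf p \<Longrightarrow> bind_pmf \<kappa> (\<lambda>k. enc k m) = \<nu>"
  shows "perfectly_secret p \<kappa> enc"
proof -
  have "cipher_experiment p \<kappa> enc = pair_pmf p \<nu>"
  proof (rule pmf_eqI)
    fix x :: "'m \<times> 'c"
    obtain m c where x: "x = (m, c)" by force
    show "pmf (cipher_experiment p \<kappa> enc) x = pmf (pair_pmf p \<nu>) x"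
      using assms[of m]
      by (cases "m \<in> set_pmf p") (auto simp: x pmf_cipher_experiment pmf_pair set_pmf_iff)
  qed
  then show ?thesis
    by (simp add: perfectly_secret_def cond_prob_pair_pmf)
qed

text \<open>Converse direction: secrecy factors the joint mass into the marginals, and
  \<open>pmf p m\<close>, positive on the support, cancels.\<close>

lemma perfectly_secretD:
  assumes secret: "perfectly_secret p \<kappa> enc" and m: "m \<in> set_pmf p"
  shows "bind_pmf \<kappa> (\<lambda>k. enc k m) = map_pmf snd (cipher_experiment p \<kappa> enc)"
proof (rule pmf_eqI)
  fix c
  let ?\<Omega> = "cipher_experiment p \<kappa> enc"
  have joint: "\<P>(\<omega> in ?\<Omega>. fst \<omega> = m \<and> snd \<omega> = c) = pmf ?\<Omega> (m, c)"
    unfolding pmf.rep_eq by (rule arg_cong2[where f = measure]) auto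
  have snd: "\<P>(\<omega> in ?\<Omega>. snd \<omega> = c) = pmf (map_pmf snd ?\<Omega>) c"
    by (simp add: pmf_map vimage_def)
  have fst: "\<P>(\<omega> in ?\<Omega>. fst \<omega> = m) = pmf p m"
    using arg_cong[OF map_fst_cipher_experiment, of "\<lambda>q. pmf q m" p \<kappa> enc]
    by (simp add: pmf_map vimage_def)
  have "pmf ?\<Omega> (m, c) = pmf p m * pmf (map_pmf snd ?\<Omega>) c"
  \<comment> \<open>Secrecy is silent about ciphertexts of probability 0; there the joint mass is
    squeezed to 0 by the marginal.\<close>
  proof (cases "pmf (map_pmf snd ?\<Omega>) c = 0")
    case True
    have "pmf ?\<Omega> (m, c) \<le> \<P>(\<omega> in ?\<Omega>. snd \<omega> = c)"
      unfolding joint[symmetric] by (rule measure_pmf.finite_measure_mono) auto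
    then show ?thesis
      using True snd pmf_nonneg[of ?\<Omega> "(m, c)"] by simp
  next
    case False
    then have "0 < \<P>(\<omega> in ?\<Omega>. snd \<omega> = c)"
      unfolding snd by (simp add: order.strict_iff_order)
    with secret have "\<P>(\<omega> in ?\<Omega>. fst \<omega> = m \<bar> snd \<omega> = c) = \<P>(\<omega> in ?\<Omega>. fst \<omega> = m)"
      unfolding perfectly_secret_def Let_def by blast
    then show ?thesis
      using False unfolding cond_prob_def joint snd fst by (simp add: field_simps)
  qed
  then show "pmf (bind_pmf \<kappa> (\<lambda>k. enc k m)) c = pmf (map_pmf snd ?\<Omega>) c"
    using m by (simp add: pmf_cipher_experiment set_pmf_iff)
qed

lemma secret_cipher_card_times_pmf_key_le:
  assumes "secret_cipher p \<kappa> enc" and fin: "finite (set_pmf p)" and k: "k \<in> set_pmf \<kappa>"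
  shows "card (set_pmf p) * pmf \<kappa> k \<le> 1"
proof -
  define \<nu> where "\<nu> = map_pmf snd (cipher_experiment p \<kappa> enc)"
  obtain dec where dec: "\<And>m c. m \<in> set_pmf p \<Longrightarrow> c \<in> set_pmf (enc k m) \<Longrightarrow> dec k c = m"
    using assms(1) k unfolding secret_cipher_def decryptable_def by blast
  have le: "pmf \<kappa> k \<le> measure_pmf.prob \<nu> (set_pmf (enc k m))" if m: "m \<in> set_pmf p" for m
  proof -
    have "perfectly_secret p \<kappa> enc"
      using assms(1) by (simp add: secret_cipher_def)
    then have \<nu>: "\<nu> = bind_pmf \<kappa> (\<lambda>k'. enc k' m)"
      unfolding \<nu>_def using m by (rule perfectly_secretD[symmetric])
    \<comment> \<open>Encryption may be randomized, so the whole support of \<open>enc k m\<close>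
      replaces a single ciphertext.\<close>
    have one: "measure (enc k m) (set_pmf (enc k m)) = 1"
      by (simp add: measure_pmf.prob_eq_1 AE_measure_pmf)
    have "emeasure \<kappa> {k} = (\<integral>\<^sup>+k'. indicator {k} k' \<partial>\<kappa>)"
      by simp
    \<comment> \<open>At \<open>k' = k\<close> the integrand is 1 by \<open>one\<close>; elsewhere
      the indicator is 0.\<close>
    also have "\<dots> \<le> (\<integral>\<^sup>+k'. emeasure (enc k' m) (set_pmf (enc k m)) \<partial>\<kappa>)"
      by (rule nn_integral_mono)
         (auto split: split_indicator simp: measure_pmf.emeasure_eq_measure one)
    also have "\<dots> = emeasure \<nu> (set_pmf (enc k m))"
      by (simp add: \<nu>)
    finally show ?thesis
      by (simp add: measure_pmf.emeasure_eq_measure pmf.rep_eq)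
  qed
  have "real (card (set_pmf p)) * pmf \<kappa> k \<le> (\<Sum>m\<in>set_pmf p. measure_pmf.prob \<nu> (set_pmf (enc k m)))"
    using sum_mono[of "set_pmf p" "\<lambda>_. pmf \<kappa> k", OF le] by simp
  \<comment> \<open>\<open>dec k\<close> separates the supports for different messages, so their
    masses add.\<close>
  also have "\<dots> = measure_pmf.prob \<nu> (\<Union>m\<in>set_pmf p. set_pmf (enc k m))"
    by (rule measure_pmf.finite_measure_finite_Union[symmetric])
       (use fin dec in \<open>auto simp: disjoint_family_on_def\<close>)
  also have "\<dots> \<le> 1"
    by simp
  finally show ?thesis .
qed

lemma shannon_entropy_message_le_key:
  assumes "secret_cipher p \<kappa> enc" and "finite (set_pmf p)"
  shows "shannon_entropy p \<le> shannon_entropy \<kappa>"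
proof -
  have "shannon_entropy p \<le> log 2 (card (set_pmf p))"
    using assms(2) by (rule shannon_entropy_le_log_card) simp
  also have "\<dots> \<le> shannon_entropy \<kappa>"
    using assms secret_cipher_card_times_pmf_key_le[OF assms]
    by (intro log_le_shannon_entropy)
       (auto simp: secret_cipher_def card_gt_0_iff set_pmf_not_empty)
  finally show ?thesis .
qed

section \<open>Size of the key space\<close>

lemma key_space_Nil: "key_space [] = {[]}"
  by (auto simp: key_space_def)

text \<open>The product structure in recursive form, for induction on the base sequence.\<close>

lemma key_space_Cons: "key_space (b # bs) = (\<lambda>(k, ks). k # ks) ` ({..<b} \<times> key_space bs)"
proof (intro equalityI subsetI)
  fix x assume x: "x \<in> key_space (b # bs)"
  then obtain k ks where "x = k # ks"
    by (cases x) (auto simp: key_space_def)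
  with x show "x \<in> (\<lambda>(k, ks). k # ks) ` ({..<b} \<times> key_space bs)"
    by (auto simp: key_space_def image_iff All_less_Suc2)
qed (auto simp: key_space_def nth_Cons split: nat.split)

lemma finite_key_space: "finite (key_space bs)"
  by (induction bs) (simp_all add: key_space_Nil key_space_Cons)

lemma card_key_space: "card (key_space bs) = prod_list bs"
proof (induction bs)
  case (Cons b bs)
  have "inj_on (\<lambda>(k, ks). k # ks) ({..<b} \<times> key_space bs)"
    by (auto simp: inj_on_def)
  then show ?case
    by (simp add: key_space_Cons card_image card_cartesian_product Cons.IH)
qed (simp add: key_space_Nil)

text \<open>A product of nonzero bases is nonzero. The condition also covers the sequence
  \<open>[1]\<close>, which can arise as \<open>[card S]\<close> below.\<close>

lemma key_space_nonempty: "0 \<notin> set bs \<Longrightarrow> key_space bs \<noteq> {}"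
  using card_key_space[of bs] by (auto simp: prod_list_zero_iff)

lemma base_sequence_nonzero: "base_sequence bs \<Longrightarrow> 0 \<notin> set bs"
  by (auto simp: base_sequence_def)

lemma shannon_entropy_mr_otp_key:
  "0 \<notin> set bs \<Longrightarrow> shannon_entropy (mr_otp_key bs) = log 2 (prod_list bs)"
  by (simp add: shannon_entropy_pmf_of_set finite_key_space key_space_nonempty card_key_space)

section \<open>Encryption as a permutation of the key space\<close>

text \<open>Transfers injectivity in the message to injectivity in the key.\<close>

lemma mr_otp_commute: "mr_otp bs k m = mr_otp bs m k"
  by (simp add: mr_otp_def add.commute)

lemma mr_otp_in_key_space: "0 \<notin> set bs \<Longrightarrow> mr_otp bs k m \<in> key_space bs"
  by (auto simp: mr_otp_def key_space_def) (metis gr0I mod_less_divisor nth_mem)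

lemma mod_add_right_cancel_less:
  fixes i j a n :: nat
  assumes "(a + i) mod n = (a + j) mod n" and "i < n" and "j < n"
  shows "i = j"
  using assms
\<comment> \<open>With \<open>i \<le> j\<close> the natural subtraction \<open>j - i\<close> is
  exact; a multiple of \<open>n\<close> below \<open>n\<close> is 0.\<close>
proof (induction i j rule: linorder_wlog)
  case (le i j)
  then have "n dvd j - i"
    using mod_eq_dvd_iff_nat[of "a + i" "a + j" n] by simp
  with le show ?case
    by (auto dest: dvd_imp_le)
qed simp

lemma inj_on_mr_otp: "inj_on (mr_otp bs k) (key_space bs)"
proof (rule inj_onI)
  fix m m' assume m: "m \<in> key_space bs" "m' \<in> key_space bs" "mr_otp bs k m = mr_otp bs k m'"
  show "m = m'"
  proof (rule nth_equalityI)
    show "length m = length m'"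
      using m by (simp add: key_space_def)
    fix i assume "i < length m"
    then have i: "i < length bs"
      using m by (simp add: key_space_def)
    then have "mr_otp bs k m ! i = mr_otp bs k m' ! i"
      using m by simp
    then have "(k ! i + m ! i) mod (bs ! i) = (k ! i + m' ! i) mod (bs ! i)"
      using i by (simp add: mr_otp_def add.commute)
    then show "m ! i = m' ! i"
      using m i by (auto simp: key_space_def intro: mod_add_right_cancel_less)
  qed
qed

text \<open>The one-time pad property: a permutation of a finite set preserves its uniform
  law.\<close>

lemma map_mr_otp_key:
  assumes "0 \<notin> set bs"
  shows "map_pmf (\<lambda>k. mr_otp bs k m) (mr_otp_key bs) = mr_otp_key bs"
proof (rule map_pmf_of_set_bij_betw)
  have inj: "inj_on (\<lambda>k. mr_otp bs k m) (key_space bs)"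
    using inj_on_mr_otp[of bs m] by (simp add: mr_otp_commute[of bs m] inj_on_def)
  moreover have "(\<lambda>k. mr_otp bs k m) ` key_space bs = key_space bs"
    \<comment> \<open>An injective self-map of a finite set is onto.\<close>
    by (rule endo_inj_surj[OF finite_key_space _ inj])
       (use assms in \<open>auto intro: mr_otp_in_key_space\<close>)
  ultimately show "bij_betw (\<lambda>k. mr_otp bs k m) (key_space bs) (key_space bs)"
    by (simp add: bij_betw_def)
qed (use assms in \<open>simp_all add: key_space_nonempty finite_key_space\<close>)

text \<open>The injective coding \<open>f\<close> lets the pad run over any sufficiently large key
  space; the identity gives MR-OTP itself.\<close>

lemma secret_cipher_coded_mr_otp:
  assumes bs: "0 \<notin> set bs" and inj: "inj_on f (set_pmf p)"
    and sub: "f ` set_pmf p \<subseteq> key_space bs"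
  shows "secret_cipher p (mr_otp_key bs) (\<lambda>k m. mr_otp_enc bs k (f m))"
proof -
  have "inj_on (\<lambda>m. mr_otp bs k (f m)) (set_pmf p)" for k
    using comp_inj_on[OF inj inj_on_subset[OF inj_on_mr_otp sub]] by (simp add: comp_def)
  then have "decryptable p (mr_otp_key bs) (\<lambda>k m. mr_otp_enc bs k (f m))"
    unfolding decryptable_def
    by (intro exI[of _ "\<lambda>k. inv_into (set_pmf p) (\<lambda>m. mr_otp bs k (f m))"])
       (auto intro: inv_into_f_f)
  moreover have "perfectly_secret p (mr_otp_key bs) (\<lambda>k m. mr_otp_enc bs k (f m))"
    \<comment> \<open>The common ciphertext law is the uniform key law.\<close>
    using map_mr_otp_key[OF bs] by (intro perfectly_secretI) (simp add: map_pmf_def)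
  moreover have "finite_key_entropy (mr_otp_key bs)"
    using bs by (intro finite_key_entropy_finite_support)
      (simp add: key_space_nonempty finite_key_space)
  ultimately show ?thesis
    by (simp add: secret_cipher_def)
qed

section \<open>Random base sequences\<close>

text \<open>Given \<open>b\<close>, the ciphertext is uniform whatever the message, so
  \<open>M\<close> is independent of the pair \<open>(B, C)\<close>.\<close>

lemma mr_otp_experiment_eq:
  assumes "\<And>b. b \<in> set_pmf \<beta> \<Longrightarrow> 0 \<notin> set b"
  shows "mr_otp_experiment \<beta> p =
    map_pmf (\<lambda>(m, b, c). (b, m, c)) (pair_pmf p (bind_pmf \<beta> (\<lambda>b. map_pmf (Pair b) (mr_otp_key b))))"
proof -
  have "mr_otp_experiment \<beta> p =
      bind_pmf \<beta> (\<lambda>b. bind_pmf p (\<lambda>m. map_pmf (\<lambda>c. (b, m, c)) (mr_otp_key b)))"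
    unfolding mr_otp_experiment_def
  proof (intro bind_pmf_cong refl)
    fix b m assume b: "b \<in> set_pmf \<beta>"
    have "bind_pmf (mr_otp_key b) (\<lambda>k. return_pmf (b, m, mr_otp b k m)) =
        map_pmf (\<lambda>c. (b, m, c)) (map_pmf (\<lambda>k. mr_otp b k m) (mr_otp_key b))"
      by (simp add: map_pmf_comp map_pmf_def[symmetric])
    then show "bind_pmf (mr_otp_key b) (\<lambda>k. return_pmf (b, m, mr_otp b k m)) =
        map_pmf (\<lambda>c. (b, m, c)) (mr_otp_key b)"
      using map_mr_otp_key[OF assms[OF b]] by simp
  qed
  also have "\<dots> = bind_pmf p (\<lambda>m. bind_pmf \<beta> (\<lambda>b. map_pmf (\<lambda>c. (b, m, c)) (mr_otp_key b)))"
    by (rule bind_commute_pmf)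
  also have "\<dots> = map_pmf (\<lambda>(m, b, c). (b, m, c))
      (pair_pmf p (bind_pmf \<beta> (\<lambda>b. map_pmf (Pair b) (mr_otp_key b))))"
    by (simp add: pair_pmf_def map_bind_pmf map_pmf_def bind_assoc_pmf bind_return_pmf)
  finally show ?thesis .
qed

text \<open>The pair \<open>(b, c)\<close> acts as one observation, independent of the
  message.\<close>

lemma mr_otp_experiment_secret:
  assumes "\<And>b. b \<in> set_pmf \<beta> \<Longrightarrow> 0 \<notin> set b"
    and "0 < \<P>((B, M, C) in mr_otp_experiment \<beta> p. C = c \<and> B = b)"
  shows "\<P>((B, M, C) in mr_otp_experiment \<beta> p. M = m \<bar> C = c \<and> B = b)
    = \<P>((B, M, C) in mr_otp_experiment \<beta> p. M = m)"
proof -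
  define \<nu> where "\<nu> = bind_pmf \<beta> (\<lambda>b. map_pmf (Pair b) (mr_otp_key b))"
  define \<Omega> where "\<Omega> = mr_otp_experiment \<beta> p"
  have \<Omega>: "measure \<Omega> A = measure (pair_pmf p \<nu>) {(M, B, C). (B, M, C) \<in> A}" for A
    using mr_otp_experiment_eq[OF assms(1), of \<beta> p]
    by (simp add: \<Omega>_def \<nu>_def vimage_def case_prod_unfold)
  have "\<P>((B, M, C) in \<Omega>. C = c \<and> B = b) = \<P>(\<omega> in pair_pmf p \<nu>. snd \<omega> = (b, c))"
    unfolding \<Omega> by (rule arg_cong2[where f = measure]) auto
  moreover have "\<P>((B, M, C) in \<Omega>. M = m) = \<P>(\<omega> in pair_pmf p \<nu>. fst \<omega> = m)"
    unfolding \<Omega> by (rule arg_cong2[where f = measure]) auto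
  moreover have "\<P>(\<omega> in \<Omega>. (case \<omega> of (B, M, C) \<Rightarrow> M = m) \<and> (case \<omega> of (B, M, C) \<Rightarrow> C = c \<and> B = b))
      = \<P>(\<omega> in pair_pmf p \<nu>. fst \<omega> = m \<and> snd \<omega> = (b, c))"
    unfolding \<Omega> by (rule arg_cong2[where f = measure]) auto
  ultimately show ?thesis
    using assms(2) cond_prob_pair_pmf[of p \<nu> "(b, c)" m]
    unfolding \<Omega>_def[symmetric] cond_prob_def by simp
qed

section \<open>Secrecy, entropy excess and minimal key entropy\<close>

theorem corollary8p17:
  fixes bs :: "nat list" and S :: "nat list set" and p :: "nat list pmf"
  assumes "base_sequence bs"
    and "S \<subseteq> key_space bs"
    and "\<forall>m. m \<notin> S \<longrightarrow> pmf p m = 0"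
  shows
    "perfectly_secret p (mr_otp_key bs) (mr_otp_enc bs)
     \<and>
     (\<forall>\<beta>. (\<forall>b\<in>set_pmf \<beta>. base_sequence b \<and> S \<subseteq> key_space b) \<longrightarrow>
       (let \<Omega> = measure_pmf (mr_otp_experiment \<beta> p) in
        \<forall>b c m. \<P>((B, M, C) in \<Omega>. C = c \<and> B = b) > 0 \<longrightarrow>
          \<P>((B, M, C) in \<Omega>. M = m \<bar> C = c \<and> B = b) = \<P>((B, M, C) in \<Omega>. M = m)))
     \<and>
     (card S < prod_list bs \<longrightarrow>
        shannon_entropy p < shannon_entropy (mr_otp_key bs) \<and>
        shannon_entropy p \<le> shannon_entropy (pmf_of_set S) \<and>
        shannon_entropy (mr_otp_key bs) - shannon_entropy (pmf_of_set S)
          = log 2 (real (prod_list bs)) - log 2 (real (card S)) \<and>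
        0 < log 2 (real (prod_list bs)) - log 2 (real (card S)))
     \<and>
     (\<forall>(\<kappa> :: 'k::countable pmf) (enc :: 'k \<Rightarrow> nat list \<Rightarrow> 'c pmf).
        secret_cipher p \<kappa> enc \<longrightarrow> shannon_entropy p \<le> shannon_entropy \<kappa>)
     \<and>
     (p = pmf_of_set S \<longrightarrow>
        (\<exists>(\<kappa> :: nat list pmf) (enc :: nat list \<Rightarrow> nat list \<Rightarrow> nat list pmf).
           secret_cipher p \<kappa> enc \<and> shannon_entropy \<kappa> = shannon_entropy p))
     \<and>
     (prod_list bs = card S \<and> p = pmf_of_set S \<longrightarrow>
        secret_cipher p (mr_otp_key bs) (mr_otp_enc bs) \<and>
        shannon_entropy (mr_otp_key bs) = shannon_entropy p \<and>
        card (key_space bs) = card S)"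
proof -
  note nz = base_sequence_nonzero[OF assms(1)]
  have supp: "set_pmf p \<subseteq> S"
    using assms(3) by (auto simp: set_pmf_iff)
  have finS: "finite S"
    using assms(2) finite_key_space by (rule finite_subset)
  have neS: "S \<noteq> {}"
    using supp set_pmf_not_empty[of p] by auto
  have fin: "finite (set_pmf p)"
    using supp finS by (rule finite_subset)
  have HS: "shannon_entropy (pmf_of_set S) = log 2 (card S)"
    using finS neS by (rule shannon_entropy_pmf_of_set)
  have HM: "shannon_entropy p \<le> log 2 (card S)"
    using finS supp by (rule shannon_entropy_le_log_card)
  have otp: "secret_cipher p (mr_otp_key bs) (mr_otp_enc bs)"
    using secret_cipher_coded_mr_otp[OF nz, of "\<lambda>m. m" p] supp assms(2) by auto
  have log_less: "log 2 (card S) < log 2 (prod_list bs)" if "card S < prod_list bs"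
    using that finS neS by (intro log_less) (auto simp: card_gt_0_iff)
  \<comment> \<open>Witness: number the elements of \<open>S\<close> by a bijection \<open>f\<close>
    and use a one-digit pad with base \<open>card S\<close>, whose key entropy is
    \<open>log 2 (card S)\<close>.\<close>
  have attained: "\<exists>(\<kappa> :: nat list pmf) (enc :: nat list \<Rightarrow> nat list \<Rightarrow> nat list pmf).
      secret_cipher p \<kappa> enc \<and> shannon_entropy \<kappa> = shannon_entropy p" if p: "p = pmf_of_set S"
  proof -
    have pos: "0 \<notin> set [card S]"
      using finS neS by auto
    obtain f where f: "bij_betw f S (key_space [card S])"
      using finite_same_card_bij[OF finS finite_key_space[of "[card S]"]]
      by (auto simp: card_key_space)
    have "secret_cipher p (mr_otp_key [card S]) (\<lambda>k m. mr_otp_enc [card S] k (f m))"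
      using f supp image_mono[OF supp, of f]
      by (intro secret_cipher_coded_mr_otp[OF pos]) (auto simp: bij_betw_def intro: inj_on_subset)
    moreover have "shannon_entropy (mr_otp_key [card S]) = shannon_entropy p"
      using shannon_entropy_mr_otp_key[OF pos] by (simp add: p HS)
    ultimately show ?thesis by blast
  qed
  show ?thesis
    unfolding Let_def
  proof (intro conjI allI impI)
    show "perfectly_secret p (mr_otp_key bs) (mr_otp_enc bs)"
      using otp by (simp add: secret_cipher_def)
  next
    fix \<beta> b c m
    assume "\<forall>b\<in>set_pmf \<beta>. base_sequence b \<and> S \<subseteq> key_space b"
      and "0 < \<P>((B, M, C) in mr_otp_experiment \<beta> p. C = c \<and> B = b)"
    then show "\<P>((B, M, C) in mr_otp_experiment \<beta> p. M = m \<bar> C = c \<and> B = b)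
        = \<P>((B, M, C) in mr_otp_experiment \<beta> p. M = m)"
      by (intro mr_otp_experiment_secret) (auto dest: base_sequence_nonzero)
  next
    fix \<kappa> :: "'k pmf" and enc :: "'k \<Rightarrow> nat list \<Rightarrow> 'c pmf"
    assume "secret_cipher p \<kappa> enc"
    then show "shannon_entropy p \<le> shannon_entropy \<kappa>"
      using fin by (rule shannon_entropy_message_le_key)
  \<comment> \<open>The remaining claims compare \<open>log 2 (prod_list bs)\<close> with
    \<open>log 2 (card S)\<close>, or are \<open>attained\<close> and \<open>otp\<close>.\<close>
  qed (use HM HS otp attained log_less shannon_entropy_mr_otp_key[OF nz] card_key_space[of bs] in
        \<open>force+\<close>)
qed

end
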